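(* Consider the online capacitated assignment problem: a finite set $S$ of servers is given in advance, each server $s$ with a positive integer capacity $u(s)$; clients arrive one at a time with all their incident edges, and each client may be assigned to a neighboring server, with server $s$ receiving at most $u(s)$ clients. The SAP protocol, upon arrival of a client $c$, augments along a shortest augmenting path from $c$ to a server $s$ currently assigned fewer than $u(s)$ clients (if one exists, ties arbitrary). Then SAP uses at most $O(n\log^2 n)$ reassignments in total, where $n$ is the number of clients.
   Context: An augmenting path from $c$ is a path starting at the unassigned client $c$, alternating between edges not in the current assignment and edges in the current assignment (a server may have several assignment edges), ending at a server with spare capacity; augmenting flips the status of all its edges. *)

theory Defs
  imports Complex_Main "HOL-Library.Landau_Symbols"
begin

text \<open>
  Clients arrive in the order of the list \<open>cs\<close>; \<open>E\<close> is the set of all client-server edges.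
  An assignment is a set of client-server edges.
\<close>

definition assignment_instance ::
  "'s set \<Rightarrow> ('s \<Rightarrow> nat) \<Rightarrow> 'c list \<Rightarrow> ('c \<times> 's) set \<Rightarrow> bool" where
  "assignment_instance S u cs E \<longleftrightarrow>
     finite S \<and> (\<forall>s\<in>S. u s > 0) \<and> distinct cs \<and> E \<subseteq> set cs \<times> S"

definition revealed :: "'c list \<Rightarrow> ('c \<times> 's) set \<Rightarrow> nat \<Rightarrow> ('c \<times> 's) set" where
  "revealed cs E i = {(c, s) \<in> E. c \<in> set (take (Suc i) cs)}"

definition load :: "('c \<times> 's) set \<Rightarrow> 's \<Rightarrow> nat" where
  "load M s = card {c. (c, s) \<in> M}"

text \<open>
  The list \<open>[(c\<^sub>0, s\<^sub>0), \<dots>, (c\<^sub>k, s\<^sub>k)]\<close> encodes the bipartite path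
  \<open>c\<^sub>0, s\<^sub>0, c\<^sub>1, s\<^sub>1, \<dots>, c\<^sub>k, s\<^sub>k\<close>. It has the \<open>k + 1\<close> edges \<open>(c\<^sub>i, s\<^sub>i)\<close> and the
  \<open>k\<close> edges \<open>(c\<^sub>i\<^sub>+\<^sub>1, s\<^sub>i)\<close>.
\<close>

definition back_edge :: "('c \<times> 's) list \<Rightarrow> nat \<Rightarrow> 'c \<times> 's" where
  "back_edge p i = (fst (p ! Suc i), snd (p ! i))"

definition path_edges :: "('c \<times> 's) list \<Rightarrow> ('c \<times> 's) set" where
  "path_edges p = set p \<union> {back_edge p i | i. Suc i < length p}"

definition path_length :: "('c \<times> 's) list \<Rightarrow> nat" where
  "path_length p = 2 * length p - 1"

definition augmenting_path ::
  "('c \<times> 's) set \<Rightarrow> ('s \<Rightarrow> nat) \<Rightarrow> ('c \<times> 's) set \<Rightarrow> 'c \<Rightarrow> ('c \<times> 's) list \<Rightarrow> bool" where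
  "augmenting_path G u M c p \<longleftrightarrow>
     p \<noteq> [] \<and> fst (hd p) = c \<and> c \<notin> Domain M \<and>
     distinct (map fst p) \<and> distinct (map snd p) \<and>
     (\<forall>i. i < length p \<longrightarrow> p ! i \<in> G - M) \<and>
     (\<forall>i. Suc i < length p \<longrightarrow> back_edge p i \<in> G \<inter> M) \<and>
     load M (snd (last p)) < u (snd (last p))"

definition shortest_augmenting_path ::
  "('c \<times> 's) set \<Rightarrow> ('s \<Rightarrow> nat) \<Rightarrow> ('c \<times> 's) set \<Rightarrow> 'c \<Rightarrow> ('c \<times> 's) list \<Rightarrow> bool" where
  "shortest_augmenting_path G u M c p \<longleftrightarrow>
     augmenting_path G u M c p \<and>
     (\<forall>q. augmenting_path G u M c q \<longrightarrow> path_length p \<le> path_length q)"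

definition augment :: "('c \<times> 's) set \<Rightarrow> ('c \<times> 's) list \<Rightarrow> ('c \<times> 's) set" where
  "augment M p = (M - path_edges p) \<union> (path_edges p - M)"

text \<open>One arrival, as a relation: ties between shortest paths are broken arbitrarily.\<close>

definition sap_step ::
  "('c \<times> 's) set \<Rightarrow> ('s \<Rightarrow> nat) \<Rightarrow> 'c \<Rightarrow> ('c \<times> 's) set \<Rightarrow> ('c \<times> 's) set \<Rightarrow> bool" where
  "sap_step G u c M M' \<longleftrightarrow>
     (if \<exists>p. augmenting_path G u M c p
      then \<exists>p. shortest_augmenting_path G u M c p \<and> M' = augment M p
      else M' = M)"

text \<open>\<open>M i\<close> is the assignment after the first \<open>i\<close> arrivals.\<close>

definition sap_run ::
  "('s \<Rightarrow> nat) \<Rightarrow> 'c list \<Rightarrow> ('c \<times> 's) set \<Rightarrow> (nat \<Rightarrow> ('c \<times> 's) set) \<Rightarrow> bool" where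
  "sap_run u cs E M \<longleftrightarrow>
     M 0 = {} \<and>
     (\<forall>i < length cs. sap_step (revealed cs E i) u (cs ! i) (M i) (M (Suc i)))"

text \<open>The first assignment of a newly arrived client is not a reassignment.\<close>

definition reassigned :: "('c \<times> 's) set \<Rightarrow> ('c \<times> 's) set \<Rightarrow> 'c set" where
  "reassigned M M' = {c. \<exists>s s'. (c, s) \<in> M \<and> (c, s') \<in> M' \<and> s \<noteq> s'}"

definition total_reassignments :: "nat \<Rightarrow> (nat \<Rightarrow> ('c \<times> 's) set) \<Rightarrow> nat" where
  "total_reassignments n M = (\<Sum>i<n. card (reassigned (M i) (M (Suc i))))"

end

theory Submission imports Defs begin

text \<open>
  For a set \<open>Z\<close> of assigned clients let \<open>|Z| - (1 - \<epsilon>) u(N(Z))\<close> be its surplus, and let \<open>Z\<close> maximise it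
  just before the client \<open>c\<close> arrives. If \<open>c\<close> has a neighbour outside \<open>N(Z)\<close>, then maximality forces
  the part of the breadth-first search from \<open>c\<close> outside \<open>N(Z)\<close> to expand by a factor of
  \<open>1 / (1 - \<epsilon>)\<close> in each saturated layer, so that an unsaturated server is met after at most about
  \<open>ln n / \<epsilon>\<close> layers. Otherwise \<open>Z \<union> {c}\<close> has the same neighbourhood as \<open>Z\<close>, and assigning \<open>c\<close>
  raises the maximal surplus by one. As the assignment respects the capacities, \<open>|Z| \<le> u(N(Z))\<close>,
  so the maximal surplus never exceeds \<open>\<epsilon> n\<close>. Hence at most \<open>\<epsilon> n\<close> arrivals cause more than about
  \<open>ln n / \<epsilon>\<close> reassignments; with \<open>\<epsilon> = ln n / h\<close>, summation over the thresholds \<open>h\<close> gives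
  \<open>n ln n\<close> times a harmonic sum.
\<close>

section \<open>Assignments and Hall's condition\<close>

definition assignment :: "('c \<times> 's) set \<Rightarrow> ('s \<Rightarrow> nat) \<Rightarrow> ('c \<times> 's) set \<Rightarrow> bool" where
  "assignment G u M \<longleftrightarrow> M \<subseteq> G \<and> single_valued M \<and> (\<forall>s. load M s \<le> u s)"

lemma card_converse_Image_eq_sum_load:
  assumes "finite M" "single_valued M" "finite T"
  shows "card (M\<inverse> `` T) = (\<Sum>s\<in>T. load M s)"
proof -
  have "M\<inverse> `` T = (\<Union>s\<in>T. {c. (c, s) \<in> M})" by auto
  moreover have "card (\<Union>s\<in>T. {c. (c, s) \<in> M}) = (\<Sum>s\<in>T. card {c. (c, s) \<in> M})"
  proof (rule card_UN_disjoint)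
    have "{c. (c, s) \<in> M} \<subseteq> Domain M" for s by auto
    then show "\<forall>s\<in>T. finite {c. (c, s) \<in> M}"
      using finite_subset finite_Domain[OF assms(1)] by blast
    show "\<forall>s\<in>T. \<forall>t\<in>T. s \<noteq> t \<longrightarrow> {c. (c, s) \<in> M} \<inter> {c. (c, t) \<in> M} = {}"
      using assms(2) by (auto dest: single_valuedD)
  qed fact
  ultimately show ?thesis by (simp add: load_def)
qed

text \<open>The necessary direction of Hall's condition with capacities: the clients of
  \<open>Z\<close> occupy separate slots at neighbouring servers.\<close>

lemma assignment_card_le_capacity:
  assumes "finite G" "assignment G u M" "Z \<subseteq> Domain M"
  shows "card Z \<le> sum u (G `` Z)"
proof -
  have fin: "finite M" "finite (G `` Z)" and "single_valued M"
    using assms by (auto simp: assignment_def intro: finite_subset finite_Image)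
  have "Z \<subseteq> M\<inverse> `` (G `` Z)" using assms by (fastforce simp: assignment_def)
  then have "card Z \<le> card (M\<inverse> `` (G `` Z))"
    by (intro card_mono) (simp_all add: fin finite_Image)
  also have "\<dots> = (\<Sum>s\<in>G `` Z. load M s)"
    by (intro card_converse_Image_eq_sum_load) fact+
  also have "\<dots> \<le> sum u (G `` Z)"
    using assms by (intro sum_mono) (simp add: assignment_def)
  finally show ?thesis .
qed

section \<open>Augmentation\<close>

lemma augment_eq:
  assumes "augmenting_path G u M c p"
  shows "augment M p = (M - {back_edge p i | i. Suc i < length p}) \<union> set p"
proof -
  have "set p \<inter> M = {}" "{back_edge p i | i. Suc i < length p} \<subseteq> M"
    using assms by (fastforce simp: augmenting_path_def in_set_conv_nth)+
  then show ?thesis by (auto simp: augment_def path_edges_def)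
qed

text \<open>The path enters every client except the unassigned \<open>c\<close> through that
  client's only \<open>M\<close>-edge. So augmenting removes the old edge of each rerouted
  client.\<close>

lemma back_edge_of_path_client:
  assumes p: "augmenting_path G u M c p" and "single_valued M" "(x, s) \<in> set p" "(x, t) \<in> M"
  obtains i where "Suc i < length p" "back_edge p i = (x, t)"
proof -
  from assms obtain i where i: "i < length p" "p ! i = (x, s)" by (auto simp: in_set_conv_nth)
  show thesis
  proof (cases i)
    case 0
    then have "x = c" using p i by (auto simp: augmenting_path_def hd_conv_nth)
    with p assms show ?thesis by (auto simp: augmenting_path_def)
  next
    case (Suc j)
    then have "back_edge p j \<in> M" using p i by (auto simp: augmenting_path_def)
    then have "back_edge p j = (x, t)"
      using i Suc assms by (auto simp: back_edge_def dest: single_valuedD)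
    then show ?thesis using that i Suc by simp
  qed
qed

text \<open>Path clients after \<open>c\<close> are entered by edges of \<open>M\<close>, so only
  \<open>c\<close> is new; a client that loses a back edge gains a forward edge, so none is
  dropped.\<close>

lemma Domain_augment:
  assumes p: "augmenting_path G u M c p"
  shows "Domain (augment M p) = insert c (Domain M)"
proof -
  have "fst (p ! 0) = c" "p \<noteq> []" using p by (auto simp: augmenting_path_def hd_conv_nth)
  then have "c \<in> Domain (set p)"
    by (metis Domain_fst image_eqI length_greater_0_conv nth_mem)
  moreover have "fst (p ! i) \<in> insert c (Domain M)" if "i < length p" for i
  proof (cases i)
    case 0 with \<open>fst (p ! 0) = c\<close> show ?thesis by simp
  next
    case (Suc j)
    then have "back_edge p j \<in> M" using p that by (auto simp: augmenting_path_def)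
    then show ?thesis using Suc by (auto simp: back_edge_def)
  qed
  then have "Domain (set p) \<subseteq> insert c (Domain M)"
    unfolding Domain_fst by (metis image_subsetI in_set_conv_nth)
  moreover have "Domain {back_edge p i | i. Suc i < length p} \<subseteq> Domain (set p)"
    by (auto simp: back_edge_def Domain_fst)
  ultimately show ?thesis unfolding augment_eq[OF p] by (auto simp: Domain_Un_eq) blast
qed

text \<open>A server inside the path exchanges one client for another; only the last server gains
  one, and it has spare capacity.\<close>

lemma load_augment_le:
  assumes p: "augmenting_path G u M c p" and fin: "finite M" and le: "load M s \<le> u s"
  shows "load (augment M p) s \<le> u s"
proof -
  define A where "A = {x. (x, s) \<in> M}"
  have finA: "finite A" unfolding A_def
    by (rule finite_subset[OF _ finite_Domain[OF fin]]) auto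
  have A: "card A \<le> u s" using le by (simp add: load_def A_def)
  show ?thesis
  proof (cases "s \<in> set (map snd p)")
    case False
    then have "{x. (x, s) \<in> augment M p} \<subseteq> A" unfolding augment_eq[OF p] A_def by force
    then show ?thesis using card_mono[OF finA] A unfolding load_def by (metis le_trans)
  next
    case True
    then obtain i where i: "i < length p" "snd (p ! i) = s" by (auto simp: in_set_conv_nth)
    have dist: "distinct (map snd p)" using p by (simp add: augmenting_path_def)
    have "x = fst (p ! i)" if "(x, s) \<in> set p" for x
    proof -
      from that obtain j where j: "j < length p" "p ! j = (x, s)" by (auto simp: in_set_conv_nth)
      then have "j = i" using i dist by (metis distinct_conv_nth length_map nth_map snd_conv)
      then show ?thesis using j by simp
    qed
    then have sub: "{x. (x, s) \<in> augment M p}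
        \<subseteq> insert (fst (p ! i)) (A - {x. \<exists>j. Suc j < length p \<and> back_edge p j = (x, s)})"
      (is "_ \<subseteq> insert _ (A - ?B)") unfolding augment_eq[OF p] A_def by force
    have "card (insert (fst (p ! i)) (A - ?B)) \<le> u s"
    proof (cases "Suc i < length p")
      case True
      then have "back_edge p i \<in> M" using p by (simp add: augmenting_path_def)
      then have b: "fst (p ! Suc i) \<in> A" "fst (p ! Suc i) \<in> ?B"
        using i True by (auto simp: A_def back_edge_def)
      then have "card (A - ?B) < card A" by (intro psubset_card_mono finA) auto
      then show ?thesis using A finA by (simp add: card_insert_if)
    next
      case False
      then have "last p = p ! i" using i
        by (metis Suc_lessI diff_Suc_1 last_conv_nth length_0_conv less_nat_zero_code)
      then have "card A < u s" using p i by (simp add: augmenting_path_def load_def A_def)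
      moreover have "card (A - ?B) \<le> card A" by (intro card_mono finA) auto
      ultimately show ?thesis using finA by (simp add: card_insert_if)
    qed
    moreover have "card {x. (x, s) \<in> augment M p} \<le> card (insert (fst (p ! i)) (A - ?B))"
      using sub finA by (intro card_mono) auto
    ultimately show ?thesis by (simp add: load_def)
  qed
qed

lemma assignment_augment:
  assumes p: "augmenting_path G u M c p" and "finite G" and M: "assignment G u M"
  shows "assignment G u (augment M p)"
proof -
  have sv: "single_valued M" and fin: "finite M"
    using M \<open>finite G\<close> by (auto simp: assignment_def intro: finite_subset)
  have dist: "distinct (map fst p)" using p by (simp add: augmenting_path_def)
  have "augment M p \<subseteq> G"
    using p M unfolding augment_eq[OF p]
    by (fastforce simp: augmenting_path_def assignment_def in_set_conv_nth)
  moreover have "single_valued (augment M p)"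
  proof (rule single_valuedI)
    fix x s t assume st: "(x, s) \<in> augment M p" "(x, t) \<in> augment M p"
    have mixed: "(x, t) \<in> {back_edge p i | i. Suc i < length p}"
      if edges: "(x, s) \<in> set p" "(x, t) \<in> M" for s t
    proof -
      obtain i where "Suc i < length p" "back_edge p i = (x, t)"
        by (rule back_edge_of_path_client[OF p sv edges])
      then show ?thesis by (metis (mono_tags, lifting) mem_Collect_eq)
    qed
    have "s = t" if "(x, s) \<in> set p" "(x, t) \<in> set p"
      using that dist by (metis eq_key_imp_eq_value)
    then show "s = t" using st mixed sv unfolding augment_eq[OF p] single_valued_def by blast
  qed
  ultimately show ?thesis
    using load_augment_le[OF p fin] M by (auto simp: assignment_def)
qed

text \<open>Only path clients can move, and the first of them, \<open>c\<close>, had no server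
  before; hence the strict inequality.\<close>

lemma card_reassigned_augment:
  assumes p: "augmenting_path G u M c p" and sv: "single_valued M"
  shows "card (reassigned M (augment M p)) < length p"
proof -
  have "reassigned M (augment M p) \<subseteq> fst ` set p - {c}"
  proof
    fix x assume "x \<in> reassigned M (augment M p)"
    then obtain s t where st: "(x, s) \<in> M" "(x, t) \<in> augment M p" "s \<noteq> t"
      by (auto simp: reassigned_def)
    then have "(x, t) \<notin> M" using sv by (auto dest: single_valuedD)
    then have "(x, t) \<in> set p" using st unfolding augment_eq[OF p] by auto
    moreover have "x \<noteq> c" using st p by (auto simp: augmenting_path_def)
    ultimately show "x \<in> fst ` set p - {c}" by force
  qed
  moreover have "c \<in> fst ` set p" using p by (auto simp: augmenting_path_def)
  ultimately have "reassigned M (augment M p) \<subset> fst ` set p" by auto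
  then have "card (reassigned M (augment M p)) < card (fst ` set p)"
    by (intro psubset_card_mono) auto
  also have "\<dots> \<le> length p" by (metis card_length length_map set_map)
  finally show ?thesis .
qed

section \<open>Breadth-first layers\<close>

text \<open>Cumulative layers of the alternating search. Forward steps may use all of
  \<open>G\<close>: for single-valued \<open>M\<close>, the \<open>M\<close>-edge of a client found
  from layer \<open>j\<close> only leads back into layer \<open>j\<close>.\<close>

primrec reach :: "('c \<times> 's) set \<Rightarrow> ('c \<times> 's) set \<Rightarrow> 'c \<Rightarrow> nat \<Rightarrow> 's set" where
  "reach G M c 0 = G `` {c}"
| "reach G M c (Suc j) = reach G M c j \<union> G `` (M\<inverse> `` reach G M c j)"

text \<open>Recording that the \<open>i\<close>-th server of the path lies in layer \<open>i\<close> exactly makes the path simple.\<close>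

lemma alternating_path_to_layer:
  assumes M: "M \<subseteq> G" "single_valued M" and c: "c \<notin> Domain M"
    and s: "s \<in> reach G M c j" "\<forall>i<j. s \<notin> reach G M c i"
  shows "\<exists>p. length p = Suc j \<and> fst (p ! 0) = c \<and> snd (p ! j) = s \<and>
           (\<forall>i\<le>j. p ! i \<in> G - M) \<and> (\<forall>i<j. back_edge p i \<in> M) \<and>
           (\<forall>i\<le>j. snd (p ! i) \<in> reach G M c i \<and> (\<forall>k<i. snd (p ! i) \<notin> reach G M c k))"
  using s
proof (induction j arbitrary: s)
  case 0
  then show ?case using c by (intro exI[of _ "[(c, s)]"]) auto
next
  case (Suc j)
  then have "s \<notin> reach G M c j" by simp
  with Suc.prems obtain x t where xt: "t \<in> reach G M c j" "(x, t) \<in> M" "(x, s) \<in> G" by auto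
  have "t \<notin> reach G M c k" if "k < j" for k
  proof
    assume "t \<in> reach G M c k"
    then have "s \<in> reach G M c (Suc k)" using xt by auto
    with Suc.prems(2) that show False by (metis Suc_mono)
  qed
  with Suc.IH xt obtain p where p: "length p = Suc j" "fst (p ! 0) = c" "snd (p ! j) = t"
    "\<forall>i\<le>j. p ! i \<in> G - M" "\<forall>i<j. back_edge p i \<in> M"
    "\<forall>i\<le>j. snd (p ! i) \<in> reach G M c i \<and> (\<forall>k<i. snd (p ! i) \<notin> reach G M c k)"
    by blast
  \<comment> \<open>The only \<open>M\<close>-partner of \<open>x\<close> is \<open>t\<close>, which
    lies in layer \<open>j\<close>, whereas \<open>s\<close> does not.\<close>
  have "(x, s) \<notin> M" using M xt \<open>s \<notin> reach G M c j\<close> by (auto dest: single_valuedD)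
  then show ?case using p xt Suc.prems
    by (intro exI[of _ "p @ [(x, s)]"])
      (auto simp: nth_append back_edge_def le_Suc_eq less_Suc_eq)
qed

text \<open>A path to the first layer containing \<open>s\<close> meets a new layer with each
  server, so its servers are distinct. So are its clients: each but \<open>c\<close> has the
  preceding server as its unique \<open>M\<close>-partner.\<close>

lemma augmenting_path_to_layer:
  assumes M: "M \<subseteq> G" "single_valued M" and c: "c \<notin> Domain M"
    and s: "s \<in> reach G M c j" "load M s < u s"
  shows "\<exists>p. augmenting_path G u M c p \<and> length p \<le> Suc j"
proof -
  define l where "l = (LEAST i. s \<in> reach G M c i)"
  have l: "s \<in> reach G M c l" "\<forall>i<l. s \<notin> reach G M c i" "l \<le> j"
    using s by (auto simp: l_def intro: LeastI Least_le dest: not_less_Least)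
  obtain p where p: "length p = Suc l" "fst (p ! 0) = c" "snd (p ! l) = s"
    "\<forall>i\<le>l. p ! i \<in> G - M" "\<forall>i<l. back_edge p i \<in> M"
    "\<forall>i\<le>l. snd (p ! i) \<in> reach G M c i \<and> (\<forall>k<i. snd (p ! i) \<notin> reach G M c k)"
    using alternating_path_to_layer[OF M c l(1,2)] by blast
  have snd_neq: "snd (p ! i) \<noteq> snd (p ! k)" if "i \<le> l" "k < i" for i k
    using p(6) that by (metis less_imp_le le_trans)
  then have "distinct (map snd p)"
    using p(1) by (auto simp: distinct_conv_nth) (metis less_Suc_eq_le linorder_neqE_nat)
  moreover have fst_neq: "fst (p ! i) \<noteq> fst (p ! k)" if ik: "i \<le> l" "k < i" for i k
  proof
    assume eq: "fst (p ! i) = fst (p ! k)"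
    obtain i' where i': "i = Suc i'" using ik by (cases i) auto
    have matched: "(fst (p ! i), snd (p ! i')) \<in> M" using p(5) ik i' by (auto simp: back_edge_def)
    show False
    proof (cases k)
      case 0 with matched eq p(2) c show ?thesis by auto
    next
      case (Suc k')
      then have "(fst (p ! k), snd (p ! k')) \<in> M" using p(5) ik by (auto simp: back_edge_def)
      with matched eq have "snd (p ! i') = snd (p ! k')" using M(2) by (auto dest: single_valuedD)
      then show False using snd_neq[of i' k'] ik i' Suc by simp
    qed
  qed
  then have "distinct (map fst p)"
    using p(1) by (auto simp: distinct_conv_nth) (metis less_Suc_eq_le linorder_neqE_nat)
  moreover have "p \<noteq> []" using p(1) by auto
  moreover have "last p = p ! l" using p(1) \<open>p \<noteq> []\<close> by (simp add: last_conv_nth)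
  ultimately have "augmenting_path G u M c p"
    using p M s c by (auto simp: augmenting_path_def hd_conv_nth less_Suc_eq_le)
  then show ?thesis using p(1) l(3) by auto
qed

section \<open>Surplus\<close>

text \<open>At \<open>\<epsilon> = 0\<close> this is Hall's deficiency with capacities; the discount
  \<open>1 - \<epsilon>\<close> allows positive values even when all of \<open>Z\<close> is
  assigned.\<close>

definition surplus :: "('c \<times> 's) set \<Rightarrow> ('s \<Rightarrow> nat) \<Rightarrow> real \<Rightarrow> 'c set \<Rightarrow> real" where
  "surplus G u \<epsilon> Z = real (card Z) - (1 - \<epsilon>) * real (sum u (G `` Z))"

definition max_surplus :: "('c \<times> 's) set \<Rightarrow> ('s \<Rightarrow> nat) \<Rightarrow> real \<Rightarrow> 'c set \<Rightarrow> real" where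
  "max_surplus G u \<epsilon> A = Max (surplus G u \<epsilon> ` Pow A)"

lemma surplus_le_max_surplus:
  "finite A \<Longrightarrow> Z \<subseteq> A \<Longrightarrow> surplus G u \<epsilon> Z \<le> max_surplus G u \<epsilon> A"
  unfolding max_surplus_def by (rule Max_ge) auto

lemma max_surplus_attained:
  assumes "finite A"
  obtains Z where "Z \<subseteq> A" "surplus G u \<epsilon> Z = max_surplus G u \<epsilon> A"
proof -
  have "max_surplus G u \<epsilon> A \<in> surplus G u \<epsilon> ` Pow A"
    unfolding max_surplus_def using assms by (intro Max_in) auto
  then show thesis using that by auto
qed

lemma max_surplus_mono:
  assumes "finite B" "A \<subseteq> B"
  shows "max_surplus G u \<epsilon> A \<le> max_surplus G u \<epsilon> B"
  by (metis assms finite_subset max_surplus_attained order_trans surplus_le_max_surplus)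

text \<open>Surplus depends only on the edges of the clients concerned, which are all known on
  arrival; this permits passing between the revealed graph and \<open>E\<close>.\<close>

lemma max_surplus_cong:
  assumes "\<And>x. x \<in> A \<Longrightarrow> G `` {x} = H `` {x}"
  shows "max_surplus G u \<epsilon> A = max_surplus H u \<epsilon> A"
proof -
  have "G `` Z = H `` Z" if "Z \<subseteq> A" for Z using assms that by blast
  then show ?thesis unfolding max_surplus_def surplus_def
    by (intro arg_cong[where f = Max] image_cong) auto
qed

lemma max_surplus_le:
  assumes "finite G" "assignment G u M" "0 \<le> \<epsilon>" "\<epsilon> \<le> 1" "card (Domain M) \<le> n"
  shows "max_surplus G u \<epsilon> (Domain M) \<le> \<epsilon> * real n"
proof -
  have fin: "finite (Domain M)"
    using assms by (auto simp: assignment_def intro: finite_subset finite_Domain)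
  then obtain Z where Z: "Z \<subseteq> Domain M" "surplus G u \<epsilon> Z = max_surplus G u \<epsilon> (Domain M)"
    by (rule max_surplus_attained)
  have "(1 - \<epsilon>) * real (card Z) \<le> (1 - \<epsilon>) * real (sum u (G `` Z))"
    using assignment_card_le_capacity[OF assms(1,2) Z(1)] assms(4)
    by (intro mult_left_mono) (simp_all only: of_nat_le_iff)
  then have "surplus G u \<epsilon> Z \<le> \<epsilon> * real (card Z)" by (simp add: surplus_def algebra_simps)
  also have "card Z \<le> n" using card_mono[OF fin Z(1)] assms(5) by simp
  then have "\<epsilon> * real (card Z) \<le> \<epsilon> * real n" using assms(3) by (intro mult_left_mono) auto
  finally show ?thesis using Z by simp
qed

text \<open>
  Outside the neighbourhood of a surplus maximiser \<open>Z\<close>, the capacity of the breadth-first layers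
  grows by a factor of \<open>1 / (1 - \<epsilon>)\<close> in every step, as long as the layers are saturated.
\<close>

lemma neighbours_of_long_client:
  assumes fin: "finite G" and M: "assignment G u M" and c: "c \<notin> Domain M"
    and pos: "\<And>s. s \<in> Range G \<Longrightarrow> u s > 0"
    and long: "\<And>q. augmenting_path G u M c q \<Longrightarrow> Suc k < length q"
    and eps: "0 \<le> \<epsilon>" "\<epsilon> \<le> 1" and n: "card (Domain M) \<le> n" "ln (real n) < \<epsilon> * real k"
    and Z: "Z \<subseteq> Domain M" "surplus G u \<epsilon> Z = max_surplus G u \<epsilon> (Domain M)"
  shows "G `` {c} \<subseteq> G `` Z"
proof (rule ccontr)
  assume "\<not> G `` {c} \<subseteq> G `` Z"
  then obtain s0 where s0: "(c, s0) \<in> G" "s0 \<notin> G `` Z" by auto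
  have sv: "single_valued M" and sub: "M \<subseteq> G" and finM: "finite M" and finD: "finite (Domain M)"
    using M fin by (auto simp: assignment_def intro: finite_subset finite_Domain)
  define T where "T j = reach G M c j - G `` Z" for j
  have reach_Range: "reach G M c j \<subseteq> Range G" for j by (induction j) auto
  then have finT: "finite (T j)" for j
    unfolding T_def using finite_Range[OF fin] by (meson finite_Diff finite_subset)
  \<comment> \<open>An unsaturated server in layer \<open>j \<le> k\<close> would give an augmenting
    path with at most \<open>k + 1\<close> forward edges, contrary to \<open>long\<close>.\<close>
  have assigned: "sum u (T j) \<le> card (M\<inverse> `` T j)" if "j \<le> k" for j
  proof -
    have "u s \<le> load M s" if s: "s \<in> T j" for s
    proof (rule ccontr)
      assume "\<not> u s \<le> load M s"
      then obtain p where "augmenting_path G u M c p" "length p \<le> Suc j"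
        using augmenting_path_to_layer[OF sub sv c] s unfolding T_def by (metis DiffD1 not_le)
      with long \<open>j \<le> k\<close> show False by fastforce
    qed
    then have "sum u (T j) \<le> (\<Sum>s\<in>T j. load M s)" by (rule sum_mono)
    then show ?thesis using card_converse_Image_eq_sum_load[OF finM sv finT] by simp
  qed
  have grow: "real (sum u (T j)) \<le> (1 - \<epsilon>) * real (sum u (T (Suc j)))" if "j < k" for j
  proof -
    \<comment> \<open>The maximality of \<open>Z\<close> is tested against
      \<open>Z \<union> ?X\<close>. Clients in \<open>?X\<close> have servers outside the
      neighbourhood of \<open>Z\<close>, so they are not in \<open>Z\<close>; their number is thus
      at most the discounted capacity of the new neighbours \<open>?N\<close>.\<close>
    let ?X = "M\<inverse> `` T j" and ?N = "G `` (M\<inverse> `` T j) - G `` Z"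
    have disj: "Z \<inter> ?X = {}" using sub by (auto simp: T_def)
    have finX: "finite ?X" "finite Z" using finM Z finD by (auto intro: finite_subset)
    have "Z \<union> ?X \<subseteq> Domain M" using Z by auto
    then have "surplus G u \<epsilon> (Z \<union> ?X) \<le> surplus G u \<epsilon> Z"
      unfolding Z(2) by (rule surplus_le_max_surplus[OF finD])
    moreover have "G `` (Z \<union> ?X) = G `` Z \<union> ?N" by auto
    then have "sum u (G `` (Z \<union> ?X)) = sum u (G `` Z \<union> ?N)" by (rule arg_cong)
    moreover have "sum u (G `` Z \<union> ?N) = sum u (G `` Z) + sum u ?N"
      by (rule sum.union_disjoint) (use fin finX in \<open>auto intro: finite_Image\<close>)
    moreover have "card (Z \<union> ?X) = card Z + card ?X" using finX disj by (simp add: card_Un_disjoint)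
    ultimately have "real (card ?X) \<le> (1 - \<epsilon>) * real (sum u ?N)"
      by (simp only: surplus_def of_nat_add) (simp add: algebra_simps del: of_nat_sum)
    also have "?N \<subseteq> T (Suc j)" by (auto simp: T_def)
    then have "sum u ?N \<le> sum u (T (Suc j))" by (intro sum_mono2 finT) auto
    then have "(1 - \<epsilon>) * real (sum u ?N) \<le> (1 - \<epsilon>) * real (sum u (T (Suc j)))"
      using eps by (intro mult_left_mono) (simp_all only: of_nat_le_iff)
    finally show ?thesis using assigned[of j] that by linarith
  qed
  have chain: "real (sum u (T 0)) \<le> (1 - \<epsilon>) ^ j * real (sum u (T j))" if "j \<le> k" for j
    using that
  proof (induction j)
    case (Suc j)
    then have "real (sum u (T 0)) \<le> (1 - \<epsilon>) ^ j * real (sum u (T j))" by simp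
    also have "\<dots> \<le> (1 - \<epsilon>) ^ j * ((1 - \<epsilon>) * real (sum u (T (Suc j))))"
      using Suc.prems eps grow[of j] by (intro mult_left_mono) auto
    finally show ?case by (simp add: mult_ac)
  qed simp
  \<comment> \<open>The server \<open>s0\<close> gives layer 0 capacity at least 1. With
    \<open>1 - \<epsilon> \<le> exp (- \<epsilon>)\<close>, growth up to layer \<open>k\<close>
    would need more than the \<open>n\<close> clients available to saturate it.\<close>
  have "s0 \<in> T 0" using s0 by (simp add: T_def)
  then have "u s0 \<le> sum u (T 0)" using finT by (intro member_le_sum) auto
  moreover have "u s0 > 0" using pos s0 by auto
  ultimately have "1 \<le> real (sum u (T 0))" by linarith
  also have "\<dots> \<le> (1 - \<epsilon>) ^ k * real (sum u (T k))" by (rule chain) simp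
  also have "sum u (T k) \<le> n"
  proof -
    have "sum u (T k) \<le> card (M\<inverse> `` T k)" by (rule assigned) simp
    also have "\<dots> \<le> card (Domain M)" by (intro card_mono finD) auto
    finally show ?thesis using n by simp
  qed
  then have "(1 - \<epsilon>) ^ k * real (sum u (T k)) \<le> exp (- \<epsilon>) ^ k * real n"
    using eps exp_ge_add_one_self[of "- \<epsilon>"]
    by (intro mult_mono power_mono) (simp_all only: of_nat_le_iff, auto)
  also have "\<dots> = real n / exp (\<epsilon> * real k)"
    by (simp add: exp_minus power_inverse field_simps flip: exp_of_nat_mult)
  finally have "exp (\<epsilon> * real k) \<le> real n" by (simp add: field_simps)
  then have "\<epsilon> * real k \<le> ln (real n)"
    by (metis exp_gt_zero ln_exp ln_le_cancel_iff order_less_le_trans)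
  with n show False by simp
qed

section \<open>Runs\<close>

lemma Image_revealed:
  "x \<in> set (take (Suc i) cs) \<Longrightarrow> revealed cs E i `` {x} = E `` {x}"
  by (auto simp: revealed_def)

text \<open>Confining assigned clients to arrived ones places \<open>M i\<close> inside the revealed
  graph, where the augmentation lemmas apply.\<close>

lemma sap_run_invariant:
  assumes inst: "assignment_instance S u cs E" and run: "sap_run u cs E M" and "i \<le> length cs"
  shows "assignment E u (M i) \<and> Domain (M i) \<subseteq> set (take i cs)"
  using \<open>i \<le> length cs\<close>
proof (induction i)
  case 0
  then show ?case using run by (auto simp: sap_run_def assignment_def single_valued_def load_def)
next
  case (Suc i)
  let ?G = "revealed cs E i"
  have IH: "assignment E u (M i)" "Domain (M i) \<subseteq> set (take i cs)" using Suc by auto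
  have take: "set (take (Suc i) cs) = insert (cs ! i) (set (take i cs))"
    using Suc.prems by (simp add: take_Suc_conv_app_nth)
  have "?G \<subseteq> E" by (auto simp: revealed_def)
  moreover have "finite E" using inst by (auto simp: assignment_instance_def intro: finite_subset)
  ultimately have finG: "finite ?G" using finite_subset by blast
  have "M i \<subseteq> ?G" using IH take by (auto simp: assignment_def revealed_def)
  then have G: "assignment ?G u (M i)" using IH by (simp add: assignment_def)
  have "sap_step ?G u (cs ! i) (M i) (M (Suc i))" using run Suc.prems by (simp add: sap_run_def)
  then consider "M (Suc i) = M i"
    | p where "augmenting_path ?G u (M i) (cs ! i) p" "M (Suc i) = augment (M i) p"
    by (auto simp: sap_step_def shortest_augmenting_path_def split: if_splits)
  then show ?case
  proof cases
    case 1
    then show ?thesis using IH take by auto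
  next
    case 2
    then show ?thesis
      using assignment_augment[OF 2(1) finG G] Domain_augment[OF 2(1)] IH take \<open>?G \<subseteq> E\<close>
      by (auto simp: assignment_def)
  qed
qed

text \<open>The maximal surplus is a potential: it never falls because assigned clients stay
  assigned. It is taken in \<open>E\<close>, not in the revealed graph, so that successive steps
  telescope.\<close>

lemma sap_step_max_surplus:
  assumes inst: "assignment_instance S u cs E" and run: "sap_run u cs E M" and i: "i < length cs"
    and eps: "0 \<le> \<epsilon>" "\<epsilon> \<le> 1" and k: "ln (real (length cs)) < \<epsilon> * real k"
  shows "max_surplus E u \<epsilon> (Domain (M i)) +
           (if card (reassigned (M i) (M (Suc i))) > k then 1 else 0)
         \<le> max_surplus E u \<epsilon> (Domain (M (Suc i)))"
proof -
  let ?G = "revealed cs E i" and ?c = "cs ! i" and ?D = "Domain (M i)"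
  note inv = sap_run_invariant[OF inst run]
  have IH: "assignment E u (M i)" "?D \<subseteq> set (take i cs)" using inv i by auto
  have take: "set (take (Suc i) cs) = insert ?c (set (take i cs))"
    using i by (simp add: take_Suc_conv_app_nth)
  have "?G \<subseteq> E" by (auto simp: revealed_def)
  moreover have "finite E" using inst by (auto simp: assignment_instance_def intro: finite_subset)
  ultimately have finG: "finite ?G" using finite_subset by blast
  have finD: "finite ?D" using IH finite_subset by blast
  have "M i \<subseteq> ?G" using IH take by (auto simp: assignment_def revealed_def)
  then have G: "assignment ?G u (M i)" using IH by (simp add: assignment_def)
  have "sap_step ?G u ?c (M i) (M (Suc i))" using run i by (simp add: sap_run_def)
  then consider "M (Suc i) = M i"
    | p where "shortest_augmenting_path ?G u (M i) ?c p" "M (Suc i) = augment (M i) p"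
    by (auto simp: sap_step_def split: if_splits)
  then show ?thesis
  proof cases
    case 1
    have "reassigned (M i) (M i) = {}"
      using IH by (auto simp: reassigned_def assignment_def dest: single_valuedD)
    then show ?thesis using 1 by simp
  next
    case (2 p)
    then have p: "augmenting_path ?G u (M i) ?c p"
      and short: "augmenting_path ?G u (M i) ?c q \<Longrightarrow> length p \<le> length q" for q
      by (auto simp: shortest_augmenting_path_def path_length_def augmenting_path_def)
    have c: "?c \<notin> ?D" using p by (simp add: augmenting_path_def)
    have D': "Domain (M (Suc i)) = insert ?c ?D" using Domain_augment[OF p] 2 by simp
    show ?thesis
    proof (cases "card (reassigned (M i) (M (Suc i))) > k")
      case False
      then show ?thesis using D' max_surplus_mono[of "insert ?c ?D" ?D] finD by auto
    next
      case True
      \<comment> \<open>More than \<open>k\<close> reassignments force \<open>k + 2\<close> forward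
        edges in \<open>p\<close>, and by minimality in every augmenting path from
        \<open>?c\<close>.\<close>
      then have len: "Suc k < length p"
        using card_reassigned_augment[OF p] G 2 by (simp add: assignment_def)
      have GE: "?G `` {x} = E `` {x}" if "x \<in> insert ?c ?D" for x
        by (rule Image_revealed) (use IH that take in auto)
      obtain Z where Z: "Z \<subseteq> ?D" "surplus ?G u \<epsilon> Z = max_surplus ?G u \<epsilon> ?D"
        using max_surplus_attained[OF finD] .
      have "?G `` {?c} \<subseteq> ?G `` Z"
      proof (rule neighbours_of_long_client[OF finG G c _ _ eps _ k Z])
        show "u s > 0" if "s \<in> Range ?G" for s
          using that inst \<open>?G \<subseteq> E\<close> by (auto simp: assignment_instance_def)
        show "Suc k < length q" if "augmenting_path ?G u (M i) ?c q" for q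
          using short[OF that] len by simp
        have "card ?D \<le> card (set cs)"
          using IH by (intro card_mono) (auto dest: in_set_takeD)
        then show "card ?D \<le> length cs" using card_length le_trans by blast
      qed
      then have "?G `` insert ?c Z = ?G `` Z" by auto
      moreover have "card (insert ?c Z) = Suc (card Z)"
        using c Z finD by (meson card_insert_disjoint finite_subset subsetD)
      ultimately have "surplus ?G u \<epsilon> (insert ?c Z) = max_surplus ?G u \<epsilon> ?D + 1"
        using Z by (simp add: surplus_def)
      moreover have "surplus ?G u \<epsilon> (insert ?c Z) \<le> max_surplus ?G u \<epsilon> (insert ?c ?D)"
        using Z finD by (intro surplus_le_max_surplus) auto
      moreover have "max_surplus ?G u \<epsilon> ?D = max_surplus E u \<epsilon> ?D"
        "max_surplus ?G u \<epsilon> (insert ?c ?D) = max_surplus E u \<epsilon> (insert ?c ?D)"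
        using GE by (auto intro!: max_surplus_cong)
      ultimately show ?thesis using True D' by simp
    qed
  qed
qed

text \<open>The potential starts at 0, gains at least 1 in every long step and ends at most at
  \<open>\<epsilon> * n\<close>.\<close>

lemma card_long_steps_le:
  assumes inst: "assignment_instance S u cs E" and run: "sap_run u cs E M"
    and eps: "0 \<le> \<epsilon>" "\<epsilon> \<le> 1" and k: "ln (real (length cs)) < \<epsilon> * real k"
  shows "real (card {i. i < length cs \<and> card (reassigned (M i) (M (Suc i))) > k})
         \<le> \<epsilon> * real (length cs)"
proof -
  let ?long = "\<lambda>i. card (reassigned (M i) (M (Suc i))) > k"
  have count: "real (card {i. i < m \<and> ?long i}) \<le> max_surplus E u \<epsilon> (Domain (M m))"
    if "m \<le> length cs" for m
    using that
  proof (induction m)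
    case 0
    then show ?case using run by (simp add: sap_run_def max_surplus_def surplus_def)
  next
    case (Suc m)
    have "{i. i < Suc m \<and> ?long i} = {i. i < m \<and> ?long i} \<union> (if ?long m then {m} else {})"
      by (auto simp: less_Suc_eq)
    then have "card {i. i < Suc m \<and> ?long i} = card {i. i < m \<and> ?long i} + (if ?long m then 1 else 0)"
      by auto
    then show ?case
      using sap_step_max_surplus[OF inst run _ eps k, of m] Suc by (auto split: if_splits)
  qed
  have inv: "assignment E u (M (length cs))" "Domain (M (length cs)) \<subseteq> set cs"
    using sap_run_invariant[OF inst run, of "length cs"] by auto
  have "card (Domain (M (length cs))) \<le> length cs"
    using card_mono[OF _ inv(2)] card_length[of cs] by simp
  moreover have "finite E"
    using inst by (auto simp: assignment_instance_def intro: finite_subset)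
  ultimately have "max_surplus E u \<epsilon> (Domain (M (length cs))) \<le> \<epsilon> * real (length cs)"
    using max_surplus_le inv eps by blast
  then show ?thesis using count[of "length cs"] by simp
qed

section \<open>Summation over thresholds\<close>

lemma sum_eq_sum_card_superlevel:
  fixes r :: "nat \<Rightarrow> nat"
  assumes "\<And>i. i < n \<Longrightarrow> r i \<le> m"
  shows "(\<Sum>i<n. r i) = (\<Sum>h<m. card {i. i < n \<and> r i > h})"
proof -
  have "r i = (\<Sum>h<m. if r i > h then 1 else 0)" if "i < n" for i
  proof -
    have "{h. h < m \<and> h < r i} = {..<r i}" using assms[OF that] by auto
    then show ?thesis by (simp add: sum.If_cases Int_def)
  qed
  then have "(\<Sum>i<n. r i) = (\<Sum>i<n. \<Sum>h<m. if r i > h then 1 else 0)" by (intro sum.cong) auto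
  also have "\<dots> = (\<Sum>h<m. \<Sum>i<n. if r i > h then 1 else 0)" by (rule sum.swap)
  also have "\<dots> = (\<Sum>h<m. card {i. i < n \<and> r i > h})"
    by (intro sum.cong) (simp_all add: sum.If_cases Int_def)
  finally show ?thesis .
qed

text \<open>By \<open>ln x \<le> x - 1\<close> at \<open>x = n / (n + 1)\<close>, each new term is
  at most the increment of the logarithm.\<close>

lemma sum_inverse_le_ln: "n > 0 \<Longrightarrow> (\<Sum>h<n. 1 / real (Suc h)) \<le> 1 + ln (real n)"
proof (induction n)
  case (Suc n)
  show ?case
  proof (cases "n = 0")
    case False
    then have "ln (real n / real (Suc n)) \<le> real n / real (Suc n) - 1"
      by (intro ln_le_minus_one) simp
    moreover have "ln (real n / real (Suc n)) = ln (real n) - ln (real (Suc n))"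
      using False by (simp add: ln_div)
    moreover have "real n / real (Suc n) - 1 = - (1 / real (Suc n))" by (simp add: field_simps)
    ultimately show ?thesis using Suc False by simp
  qed simp
qed simp

lemma total_reassignments_le:
  assumes inst: "assignment_instance S u cs E" and run: "sap_run u cs E M"
  defines "n \<equiv> length cs"
  shows "real (total_reassignments n M) \<le> 2 * real n + real n * ln (real n) * (1 + ln (real n))"
proof -
  define r where "r i = card (reassigned (M i) (M (Suc i)))" for i
  define g where "g h = card {i. i < n \<and> r i > h}" for h
  have g_le: "g h \<le> n" for h
    unfolding g_def using card_mono[of "{..<n}" "{i. i < n \<and> r i > h}"] by auto
  have r_le: "r i \<le> n" if "i < n" for i
  proof -
    have "reassigned (M i) (M (Suc i)) \<subseteq> set cs"
      using sap_run_invariant[OF inst run, of i] that set_take_subset[of i cs]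
      by (auto simp: reassigned_def n_def)
    then show ?thesis unfolding r_def n_def using card_mono[OF finite_set] card_length le_trans by blast
  qed
  have long: "real (g (Suc (Suc h))) \<le> real n * ln (real n) * (1 / real (Suc h))" if "n \<ge> 2" for h
  proof -
    \<comment> \<open>Dividing by \<open>h + 1\<close> while counting at threshold
      \<open>h + 2\<close> yields the strict inequality \<open>ln n < \<epsilon> * (h + 2)\<close>
      required by \<open>card_long_steps_le\<close>.\<close>
    define \<epsilon> where "\<epsilon> = ln (real n) / real (Suc h)"
    have L: "ln (real n) > 0" using that by simp
    show ?thesis
    proof (cases "\<epsilon> \<le> 1")
      case True
      have "ln (real n) = \<epsilon> * real (Suc h)" unfolding \<epsilon>_def by (simp del: of_nat_Suc)
      also have "\<dots> < \<epsilon> * real (Suc (Suc h))"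
        using L by (intro mult_strict_left_mono) (simp_all add: \<epsilon>_def)
      finally have "ln (real (length cs)) < \<epsilon> * real (Suc (Suc h))" by (simp add: n_def)
      moreover have "0 \<le> \<epsilon>" using L by (simp add: \<epsilon>_def)
      ultimately have "real (g (Suc (Suc h))) \<le> \<epsilon> * real n"
        using card_long_steps_le[OF inst run _ True] by (simp add: g_def r_def n_def)
      then show ?thesis by (simp add: \<epsilon>_def mult_ac)
    next
      case False
      \<comment> \<open>For \<open>\<epsilon> > 1\<close> the trivial bound \<open>n\<close> is
        already below \<open>\<epsilon> * n\<close>.\<close>
      have "real (g (Suc (Suc h))) \<le> real n * 1" using g_le by simp
      also have "\<dots> \<le> real n * \<epsilon>" using False by (intro mult_left_mono) auto
      finally show ?thesis by (simp add: \<epsilon>_def)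
    qed
  qed
  \<comment> \<open>Thresholds from \<open>n\<close> on contribute nothing; \<open>n + 2\<close> of
    them are taken so that, after the two lowest are bounded by \<open>n\<close> each, a harmonic
    sum of \<open>n\<close> terms remains.\<close>
  have "total_reassignments n M = (\<Sum>h<Suc (Suc n). g h)"
    unfolding total_reassignments_def g_def r_def[symmetric]
    using r_le by (intro sum_eq_sum_card_superlevel) (simp add: le_Suc_eq)
  also have "\<dots> = g 0 + g (Suc 0) + (\<Sum>h<n. g (Suc (Suc h)))"
    by (simp add: sum.lessThan_Suc_shift del: sum.lessThan_Suc)
  finally have total: "real (total_reassignments n M)
      \<le> 2 * real n + (\<Sum>h<n. real (g (Suc (Suc h))))"
    using g_le[of 0] g_le[of "Suc 0"] by simp
  show ?thesis
  proof (cases "n \<ge> 2")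
    case True
    have "(\<Sum>h<n. real (g (Suc (Suc h)))) \<le> (\<Sum>h<n. real n * ln (real n) * (1 / real (Suc h)))"
      by (intro sum_mono long True)
    also have "\<dots> = real n * ln (real n) * (\<Sum>h<n. 1 / real (Suc h))"
      by (rule sum_distrib_left[symmetric])
    also have "\<dots> \<le> real n * ln (real n) * (1 + ln (real n))"
      using True by (intro mult_left_mono sum_inverse_le_ln) auto
    finally show ?thesis using total by simp
  next
    case False
    \<comment> \<open>For \<open>n \<le> 1\<close> the logarithmic term is zero, and one
      reassignment per arrival fits into \<open>2 * n\<close>.\<close>
    have "r i \<le> 1" if "i < n" for i using r_le[OF that] False by simp
    then have "(\<Sum>i<n. r i) \<le> (\<Sum>i<n. 1)" by (intro sum_mono) simp
    then show ?thesis using False unfolding total_reassignments_def r_def[symmetric]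
      by (cases "n = 0") (auto simp: not_le less_Suc_eq numeral_2_eq_2)
  qed
qed

text \<open>Since \<open>f\<close> is fixed before the instance and the run, the bound is uniform
  over graphs, capacities, arrival orders and tie-breaking.\<close>

theorem theorem3:
  "\<exists>f :: nat \<Rightarrow> real. f \<in> O(\<lambda>n. real n * (ln (real n))\<^sup>2) \<and>
     (\<forall>(S :: 's set) (u :: 's \<Rightarrow> nat) (cs :: 'c list) (E :: ('c \<times> 's) set) M.
        assignment_instance S u cs E \<longrightarrow> sap_run u cs E M \<longrightarrow>
        real (total_reassignments (length cs) M) \<le> f (length cs))"
proof (intro exI conjI allI impI)
  let ?f = "\<lambda>n. 2 * real n + real n * ln (real n) * (1 + ln (real n))"
  show "?f \<in> O(\<lambda>n. real n * (ln (real n))\<^sup>2)"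
  proof (rule bigoI)
    \<comment> \<open>From \<open>n = 3\<close> on, \<open>ln n \<ge> 1\<close>, so
      \<open>2\<close>, \<open>ln n\<close> and its square are at most 2, 1 and 1 times the square;
      the constant is their sum 4.\<close>
    show "\<forall>\<^sub>F n in sequentially. norm (?f n) \<le> 4 * norm (real n * (ln (real n))\<^sup>2)"
      using eventually_ge_at_top[of 3]
    proof eventually_elim
      case (elim n)
      have "exp 1 \<le> (3 :: real)" by (rule exp_le)
      then have "exp 1 \<le> real n" using elim by linarith
      then have l: "1 \<le> ln (real n)" using elim by (subst ln_ge_iff) auto
      then have "1 \<le> (ln (real n))\<^sup>2" "ln (real n) \<le> (ln (real n))\<^sup>2"
        by (auto simp: power2_eq_square intro: mult_left_le)
          (metis l mult_le_cancel_left1 order_trans zero_le_one mult_mono mult_1)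
      then have "2 + ln (real n) * (1 + ln (real n)) \<le> 4 * (ln (real n))\<^sup>2"
        by (simp add: algebra_simps power2_eq_square)
      then have "real n * (2 + ln (real n) * (1 + ln (real n))) \<le> real n * (4 * (ln (real n))\<^sup>2)"
        by (intro mult_left_mono) auto
      moreover have "0 \<le> ?f n" using l by simp
      ultimately show ?case by (simp add: algebra_simps)
    qed
  qed
  show "real (total_reassignments (length cs) M) \<le> ?f (length cs)"
    if "assignment_instance S u cs E" "sap_run u cs E M"
    for S :: "'s set" and u and cs :: "'c list" and E M
    using total_reassignments_le[OF that] .
qed

end
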